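(* Let $n\ge1$ and $p\ge 1$ be integers and let $a_1,\dots,a_p,b_1,\dots,b_p$ be non-zero complex numbers, with no $b_i$ a non-positive integer. Suppose that $$f(x)=x\sum_{k=0}^\infty\frac{(a_1)_k\cdots(a_p)_k}{(b_1)_k\cdots(b_p)_k}x^k$$ is an eigenfunction of $U_n$ with eigenvalue $\lambda$, i.e. $U_nf=\lambda f$. Let $\gamma_a=|\{i\in\{1,\dots,p\}: a_i=1\}|$ and $\gamma_b=|\{i\in\{1,\dots,p\}: b_i=1\}|$. Then $$\lambda=n^{\gamma_b-\gamma_a}.$$
   Context: All series are formal power series over $\mathbb{C}$. The operator $U_n$ acts by $U_n\left(\sum_{k\ge0} c_k x^k\right) = \sum_{k\ge 0} c_{nk}x^k$. The ascending factorial is $(c)_0=1$, $(c)_k = c(c+1)\cdots(c+k-1)$.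
   Formalization: The eigenvalue λ is additionally assumed non-zero; as printed the claim fails for λ=0, e.g. p=1, a_1=-1, b_1=1/2, n=3, where f=x-2x^2 and U_3 f=0, while the formula would give λ=1. *)

theory Defs
  imports "HOL-Computational_Algebra.Formal_Power_Series" "HOL-Library.Nonpos_Ints"
begin

definition U_op :: "nat \<Rightarrow> complex fps \<Rightarrow> complex fps" where
  "U_op n f = Abs_fps (\<lambda>k. fps_nth f (n * k))"

(* The denominator has no vanishing factor as long as no b i with i in {1..p} is a
   non-positive integer; otherwise x / 0 = 0 makes the coefficient meaningless. *)
definition hyp_series :: "nat \<Rightarrow> (nat \<Rightarrow> complex) \<Rightarrow> (nat \<Rightarrow> complex) \<Rightarrow> complex fps" where
  "hyp_series p a b = fps_X * Abs_fps (\<lambda>k.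
     (\<Prod>i=1..p. pochhammer (a i) k) / (\<Prod>i=1..p. pochhammer (b i) k))"

definition gam :: "nat \<Rightarrow> (nat \<Rightarrow> complex) \<Rightarrow> nat" where
  "gam p c = card {i \<in> {1..p}. c i = 1}"

(* The eigenvalue 0 has to be excluded when one considers the equation
   U_op n f = fps_const ev * f for f = hyp_series p a b: if some a i is a negative integer,
   f is a polynomial, and U_op n f = 0 as soon as n exceeds its degree
   (e.g. p = 1, a 1 = -1, n = 3, where f = x - x^2 / b 1).
   In all other cases ev = fps_nth f n is automatically non-zero. *)

end

theory Submission
  imports Defs "HOL-Computational_Algebra.Polynomial"
begin

text \<open>
  Write \<open>c\<^sub>m\<close> for the coefficients of the series \<open>f\<close>, so that \<open>c\<^sub>1 = 1\<close> and the
  eigenvalue equation says \<open>c\<^bsub>n m\<^esub> = \<lambda> c\<^sub>m\<close>; in particular \<open>\<lambda> = c\<^sub>n\<close>. The case \<open>n = 1\<close> is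
  immediate, so let \<open>n \<ge> 2\<close>. As \<open>\<lambda> \<noteq> 0\<close>, no coefficient with \<open>m \<ge> 1\<close> vanishes, and consecutive
  coefficients have the quotient \<open>r(m)\<close>, where
  \<open>r(x) = \<Prod>\<^sub>i (x + a\<^sub>i - 1) / \<Prod>\<^sub>i (x + b\<^sub>i - 1)\<close>. Telescoping \<open>c\<^bsub>n(m+1)\<^esub> / c\<^bsub>n m\<^esub> = c\<^bsub>m+1\<^esub> / c\<^sub>m\<close>
  gives \<open>r(m) = \<Prod>\<^bsub>j<n\<^esub> r(n m + j)\<close> for all \<open>m \<ge> 1\<close>, which is then an identity of rational
  functions.

  Comparing orders at every point, the divisor \<open>D\<close> of \<open>r\<close> satisfies
  \<open>D(y) = \<Sum>\<^bsub>j<n\<^esub> D(n y + j)\<close> (\<open>net_order_self_similar\<close>). The maps \<open>y \<mapsto> n y + j\<close> expand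
  distances, so a finitely supported \<open>D\<close> with this property can only live at their extreme fixed
  points \<open>0\<close> and \<open>-1\<close>, with opposite values there (\<open>self_similar_divisor\<close>). Hence
  \<open>r(x) = (x / (x + 1))\<^sup>d\<close> with \<open>d = D(0) = \<gamma>\<^sub>a - \<gamma>\<^sub>b\<close>, since \<open>a\<^sub>i = 1\<close> contributes a zero
  and \<open>b\<^sub>i = 1\<close> a pole at \<open>0\<close>. The product of the \<open>r(k)\<close> telescopes to \<open>c\<^sub>m = m\<^bsup>-d\<^esup>\<close>, and
  \<open>m = n\<close> gives the eigenvalue.
\<close>

section \<open>Divisors invariant under multiplication by n\<close>

lemma finite_maximizer:
  fixes f :: "'a \<Rightarrow> 'b :: linorder"
  assumes "finite S" "y \<in> S"
  shows "\<exists>z\<in>S. \<forall>w\<in>S. f w \<le> f z"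
proof -
  have "Max (f ` S) \<in> f ` S" using assms by (intro Max_in) auto
  then obtain z where "z \<in> S" "f z = Max (f ` S)" by force
  with assms show ?thesis by (intro bexI[of _ z]) auto
qed

text \<open>
  Every point of the support has an image under some \<open>y \<mapsto> n y + j\<close> in the support. These maps
  multiply the imaginary part by \<open>n\<close>, and push real points right of \<open>0\<close> further right and points
  left of \<open>-1\<close> further left, so finiteness confines the support to \<open>[-1, 0]\<close>. A point \<open>z\<close> of the
  open interval is excluded in the opposite direction: the equation at \<open>z / n\<close> involves the
  points \<open>z + j\<close>, of which only \<open>z\<close> lies in \<open>[-1, 0]\<close>; so \<open>z / n\<close> is again in the support, and so
  on towards \<open>0\<close>. Finally, the equation at \<open>-1 / n\<close>, where \<open>D\<close> vanishes, relates the
  values at \<open>-1\<close> and \<open>0\<close>.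
\<close>

lemma self_similar_divisor:
  fixes D :: "complex \<Rightarrow> int" and n :: nat
  assumes n: "n \<ge> 2" and fin: "finite {y. D y \<noteq> 0}"
    and D: "\<And>y. D y = (\<Sum>j<n. D (of_nat n * y + of_nat j))"
  shows "{y. D y \<noteq> 0} \<subseteq> {0, -1}" and "D 0 + D (-1) = 0"
proof -
  define S where "S = {y. D y \<noteq> 0}"
  have finS: "finite S" using fin by (simp add: S_def)
  have step: "\<exists>j<n. of_nat n * y + of_nat j \<in> S" if "y \<in> S" for y
  proof (rule ccontr)
    assume "\<not> ?thesis"
    hence "(\<Sum>j<n. D (of_nat n * y + of_nat j)) = 0"
      by (intro sum.neutral) (auto simp: S_def)
    with D[of y] that show False by (simp add: S_def)
  qed
  have n': "real n - 1 > 0" using n by simp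
  have real: "Im y = 0" if yS: "y \<in> S" for y
  proof (rule ccontr)
    assume "Im y \<noteq> 0"
    obtain z where z: "z \<in> S" "\<And>w. w \<in> S \<Longrightarrow> \<bar>Im w\<bar> \<le> \<bar>Im z\<bar>"
      using finite_maximizer[OF finS yS, of "\<lambda>z. \<bar>Im z\<bar>"] by auto
    obtain j where "of_nat n * z + of_nat j \<in> S" using step z(1) by blast
    hence "real n * \<bar>Im z\<bar> \<le> \<bar>Im z\<bar>" using z(2)[of "of_nat n * z + of_nat j"] by (simp add: abs_mult)
    hence "(real n - 1) * \<bar>Im z\<bar> \<le> 0" by (simp add: algebra_simps)
    hence "\<bar>Im z\<bar> \<le> 0" using n' by (simp add: mult_le_0_iff)
    with z(2)[OF yS] \<open>Im y \<noteq> 0\<close> show False by simp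
  qed
  have upper: "Re y \<le> 0" if yS: "y \<in> S" for y
  proof -
    obtain z where z: "z \<in> S" "\<And>w. w \<in> S \<Longrightarrow> Re w \<le> Re z"
      using finite_maximizer[OF finS yS, of Re] by auto
    obtain j where "of_nat n * z + of_nat j \<in> S" using step z(1) by blast
    hence "real n * Re z + real j \<le> Re z" using z(2)[of "of_nat n * z + of_nat j"] by simp
    hence "(real n - 1) * Re z \<le> 0" by (simp add: algebra_simps)
    hence "Re z \<le> 0" using n' by (simp add: mult_le_0_iff)
    with z(2)[OF yS] show ?thesis by simp
  qed
  have lower: "Re y \<ge> -1" if yS: "y \<in> S" for y
  proof -
    obtain z where z: "z \<in> S" "\<And>w. w \<in> S \<Longrightarrow> Re z \<le> Re w"
      using finite_maximizer[OF finS yS, of "\<lambda>z. - Re z"] by auto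
    obtain j where j: "j < n" "of_nat n * z + of_nat j \<in> S" using step z(1) by blast
    hence "Re z \<le> real n * Re z + real j" using z(2)[of "of_nat n * z + of_nat j"] by simp
    moreover have "real j \<le> real n - 1" using j(1) by linarith
    ultimately have "0 \<le> (real n - 1) * (Re z + 1)" by (simp add: algebra_simps)
    hence "-1 \<le> Re z" using n' by (simp add: zero_le_mult_iff)
    with z(2)[OF yS] show ?thesis by simp
  qed
  have supp: "S \<subseteq> {0, -1}"
  proof (rule ccontr)
    assume "\<not> S \<subseteq> {0, -1}"
    then obtain y where y: "y \<in> S - {0, -1}" by blast
    obtain z where z: "z \<in> S - {0, -1}" "\<And>w. w \<in> S - {0, -1} \<Longrightarrow> norm z \<le> norm w"
      using finite_maximizer[OF finite_Diff[OF finS] y, of "\<lambda>z. - norm z"] by auto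
    have im: "Im z = 0" using real z by auto
    have bounds: "Re z < 0" "-1 < Re z"
      using z(1) im upper[of z] lower[of z] by (auto simp: complex_eq_iff)
    \<comment> \<open>The preimage of \<open>z\<close> under \<open>y \<mapsto> n y\<close> is in the support, but closer to \<open>0\<close>.\<close>
    let ?w = "z / of_nat n"
    have nz: "of_nat n * ?w = z" using n by simp
    have zero: "D (z + of_nat j) = 0" if "j > 0" for j
      using upper[of "z + of_nat j"] bounds that by (auto simp: S_def)
    have "D ?w = (\<Sum>j<n. D (z + of_nat j))" using D[of ?w] nz by simp
    also have "\<dots> = (\<Sum>j\<in>{0}. D (z + of_nat j))"
      using n zero by (intro sum.mono_neutral_right) auto
    finally have "D ?w = D z" by simp
    hence w: "?w \<in> S" using z by (simp add: S_def)
    have nw: "norm ?w < norm z" using z(1) n by (simp add: norm_divide field_simps)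
    have "norm z < 1" using bounds im by (simp add: cmod_def)
    hence "?w \<noteq> -1" using nw by (metis norm_minus_cancel norm_one order.asym)
    moreover have "?w \<noteq> 0" using z n by simp
    ultimately show False using z(2)[of ?w] w nw by simp
  qed
  thus "{y. D y \<noteq> 0} \<subseteq> {0, -1}" by (simp add: S_def)
  have out: "D y = 0" if "y \<noteq> 0" "y \<noteq> -1" for y
    using supp that by (auto simp: S_def)
  let ?y = "- 1 / of_nat n :: complex"
  have "of_nat n * ?y = -1" using n by simp
  hence "D ?y = (\<Sum>j<n. D (of_nat j - 1))" using D[of ?y] by simp
  also have "\<dots> = (\<Sum>j\<in>{0,1}. D (of_nat j - 1))"
  proof (intro sum.mono_neutral_right ballI)
    show "{0, 1} \<subseteq> {..<n}" using n by auto
    fix j assume "j \<in> {..<n} - {0, 1}"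
    thus "D (of_nat j - 1) = 0" by (intro out) auto
  qed auto
  finally have "D ?y = D 0 + D (-1)" by simp
  moreover have "?y \<noteq> -1" using n by (auto simp: field_simps)
  ultimately show "D 0 + D (-1) = 0" using out[of ?y] n by simp
qed

section \<open>The divisor of a quotient of products of linear factors\<close>

text \<open>
  The divisor of the rational function \<open>\<Prod>\<^sub>i (x + \<alpha>\<^sub>i) / \<Prod>\<^sub>i (x + \<beta>\<^sub>i)\<close>. Counting linear factors
  on each side makes it independent of cancellations between numerator and denominator.
\<close>

definition net_order :: "'i set \<Rightarrow> ('i \<Rightarrow> complex) \<Rightarrow> ('i \<Rightarrow> complex) \<Rightarrow> complex \<Rightarrow> int" where
  "net_order I \<alpha> \<beta> y = int (card {i \<in> I. y + \<alpha> i = 0}) - int (card {i \<in> I. y + \<beta> i = 0})"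

lemma net_order_support:
  "{y. net_order I \<alpha> \<beta> y \<noteq> 0} \<subseteq> (\<lambda>i. - \<alpha> i) ` I \<union> (\<lambda>i. - \<beta> i) ` I"
proof
  fix y assume "y \<in> {y. net_order I \<alpha> \<beta> y \<noteq> 0}"
  hence "card {i \<in> I. y + \<alpha> i = 0} \<noteq> 0 \<or> card {i \<in> I. y + \<beta> i = 0} \<noteq> 0"
    by (auto simp: net_order_def simp del: card_eq_0_iff card_0_eq)
  then obtain i where "i \<in> I" "y + \<alpha> i = 0 \<or> y + \<beta> i = 0"
    by (auto simp: card_eq_0_iff)
  thus "y \<in> (\<lambda>i. - \<alpha> i) ` I \<union> (\<lambda>i. - \<beta> i) ` I"
    by (auto simp: add_eq_0_iff2)
qed

lemma prod_eq_prod_roots: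
  fixes \<alpha> :: "'i \<Rightarrow> complex"
  assumes "finite I" "finite T" "(\<lambda>i. - \<alpha> i) ` I \<subseteq> T"
  shows "(\<Prod>i\<in>I. x + \<alpha> i) = (\<Prod>y\<in>T. (x - y) ^ card {i \<in> I. y + \<alpha> i = 0})"
proof -
  have "(\<Prod>i\<in>I. x + \<alpha> i) = (\<Prod>y\<in>T. \<Prod>i\<in>{i \<in> I. - \<alpha> i = y}. x + \<alpha> i)"
    using assms by (rule prod.group[symmetric])
  also have "\<dots> = (\<Prod>y\<in>T. (x - y) ^ card {i \<in> I. y + \<alpha> i = 0})"
  proof (rule prod.cong[OF refl])
    fix y
    have "{i \<in> I. - \<alpha> i = y} = {i \<in> I. y + \<alpha> i = 0}"
      by (auto simp: add_eq_0_iff2)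
    moreover have "(\<Prod>i\<in>{i \<in> I. - \<alpha> i = y}. x + \<alpha> i) = (\<Prod>i\<in>{i \<in> I. - \<alpha> i = y}. x - y)"
      by (rule prod.cong) auto
    ultimately show "(\<Prod>i\<in>{i \<in> I. - \<alpha> i = y}. x + \<alpha> i) = (x - y) ^ card {i \<in> I. y + \<alpha> i = 0}"
      by simp
  qed
  finally show ?thesis .
qed

text \<open>
  The rational function is recovered from its divisor, because all the linear factors are monic.
  Factors common to numerator and denominator cancel, which is why the right-hand side ranges only
  over a set that contains the support of the divisor.
\<close>

lemma prod_ratio_eq_prod_net_order:
  assumes I: "finite I" and S: "finite S" "{y. net_order I \<alpha> \<beta> y \<noteq> 0} \<subseteq> S"
    and nz: "\<And>i. i \<in> I \<Longrightarrow> x + \<alpha> i \<noteq> 0" "\<And>i. i \<in> I \<Longrightarrow> x + \<beta> i \<noteq> 0"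
    and xS: "x \<notin> S"
  shows "(\<Prod>i\<in>I. x + \<alpha> i) / (\<Prod>i\<in>I. x + \<beta> i) = (\<Prod>y\<in>S. (x - y) powi net_order I \<alpha> \<beta> y)"
proof -
  \<comment> \<open>On \<open>T\<close> numerator and denominator factor separately; outside \<open>S\<close> they cancel.\<close>
  define T where "T = S \<union> (\<lambda>i. - \<alpha> i) ` I \<union> (\<lambda>i. - \<beta> i) ` I"
  have finT: "finite T" using I S by (simp add: T_def)
  have xT: "x - y \<noteq> 0" if "y \<in> T" for y using that nz xS unfolding T_def by force
  have "(\<Prod>i\<in>I. x + \<alpha> i) / (\<Prod>i\<in>I. x + \<beta> i) =
    (\<Prod>y\<in>T. (x - y) ^ card {i \<in> I. y + \<alpha> i = 0} / (x - y) ^ card {i \<in> I. y + \<beta> i = 0})"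
    using prod_eq_prod_roots[OF I finT, of \<alpha> x] prod_eq_prod_roots[OF I finT, of \<beta> x]
    by (auto simp: T_def prod_dividef)
  also have "\<dots> = (\<Prod>y\<in>T. (x - y) powi net_order I \<alpha> \<beta> y)"
    using xT by (intro prod.cong) (auto simp: net_order_def power_int_diff)
  also have "\<dots> = (\<Prod>y\<in>S. (x - y) powi net_order I \<alpha> \<beta> y)"
  proof (rule prod.mono_neutral_right[OF finT])
    have "net_order I \<alpha> \<beta> y = 0" if "y \<notin> S" for y using S(2) that by blast
    thus "\<forall>y\<in>T - S. (x - y) powi net_order I \<alpha> \<beta> y = 1" by simp
  qed (auto simp: T_def)
  finally show ?thesis .
qed

lemma order_prod:
  fixes f :: "'i \<Rightarrow> 'a :: idom poly"
  assumes "\<And>i. i \<in> I \<Longrightarrow> f i \<noteq> 0"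
  shows "order y (\<Prod>i\<in>I. f i) = (\<Sum>i\<in>I. order y (f i))"
  using assms
proof (induction I rule: infinite_finite_induct)
  case (insert i I)
  hence "f i * (\<Prod>i\<in>I. f i) \<noteq> 0" by auto
  with insert show ?case by (simp add: order_mult)
qed auto

lemma order_linear:
  fixes c s y :: "'a :: field"
  assumes "s \<noteq> 0"
  shows "order y [:c, s:] = (if s * y + c = 0 then 1 else 0)"
proof (cases "s * y + c = 0")
  case True
  hence "c = - (s * y)" by (simp add: eq_neg_iff_add_eq_0 add.commute)
  hence "[:c, s:] = smult s [:-y, 1:]" by simp
  thus ?thesis using True assms order_power_n_n[of y 1] by (simp add: order_smult del: smult_pCons)
next
  case False
  thus ?thesis by (simp add: order_0I algebra_simps)
qed

lemma order_prod_linear: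
  fixes c :: "'i \<Rightarrow> 'a :: field"
  assumes "finite I" "s \<noteq> 0"
  shows "order y (\<Prod>i\<in>I. [:c i, s:]) = card {i \<in> I. s * y + c i = 0}"
  using assms by (subst order_prod) (auto simp: order_linear sum.If_cases Int_def)

text \<open>
  The hypothesis is \<open>r(x) = \<Prod>\<^bsub>j<n\<^esub> r(n x + j)\<close> for \<open>r = \<Prod>\<^sub>i (x + \<alpha>\<^sub>i) / \<Prod>\<^sub>i (x + \<beta>\<^sub>i)\<close>, with
  denominators cleared. Infinitely many points make it an identity of polynomials, so both sides
  have the same order at \<open>y\<close>; and \<open>n x + j + \<gamma>\<close> has a zero at \<open>x = y\<close> exactly when \<open>x + \<gamma>\<close> has one
  at \<open>x = n y + j\<close>.
\<close>

lemma net_order_self_similar: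
  fixes \<alpha> \<beta> :: "'i \<Rightarrow> complex" and n :: nat
  assumes I: "finite I" and n: "n \<ge> 1" and X: "infinite X"
    and eq: "\<And>x. x \<in> X \<Longrightarrow>
      (\<Prod>i\<in>I. x + \<alpha> i) * (\<Prod>j<n. \<Prod>i\<in>I. of_nat n * x + of_nat j + \<beta> i) =
      (\<Prod>i\<in>I. x + \<beta> i) * (\<Prod>j<n. \<Prod>i\<in>I. of_nat n * x + of_nat j + \<alpha> i)"
  shows "net_order I \<alpha> \<beta> y = (\<Sum>j<n. net_order I \<alpha> \<beta> (of_nat n * y + of_nat j))"
proof -
  define P where "P \<gamma> = (\<Prod>i\<in>I. [:\<gamma> i, 1:])" for \<gamma> :: "'i \<Rightarrow> complex"
  define R where "R \<gamma> j = (\<Prod>i\<in>I. [:of_nat j + \<gamma> i, of_nat n:])" for \<gamma> :: "'i \<Rightarrow> complex" and j :: nat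
  have nz: "P \<gamma> \<noteq> 0" "R \<gamma> j \<noteq> 0" for \<gamma> j using I n by (auto simp: P_def R_def)
  let ?E = "P \<alpha> * (\<Prod>j<n. R \<beta> j) - P \<beta> * (\<Prod>j<n. R \<alpha> j)"
  have "X \<subseteq> {x. poly ?E x = 0}"
    using eq by (auto simp: P_def R_def poly_prod algebra_simps)
  hence "?E = 0" using X poly_roots_finite finite_subset by blast
  hence "order y (P \<alpha> * (\<Prod>j<n. R \<beta> j)) = order y (P \<beta> * (\<Prod>j<n. R \<alpha> j))" by simp
  hence "order y (P \<alpha>) + (\<Sum>j<n. order y (R \<beta> j)) = order y (P \<beta>) + (\<Sum>j<n. order y (R \<alpha> j))"
    using nz by (simp add: order_mult order_prod)
  moreover have "order y (P \<gamma>) = card {i \<in> I. y + \<gamma> i = 0}" for \<gamma>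
    using order_prod_linear[OF I, of 1 y \<gamma>] by (simp add: P_def)
  moreover have "order y (R \<gamma> j) = card {i \<in> I. of_nat n * y + of_nat j + \<gamma> i = 0}" for \<gamma> j
    using order_prod_linear[OF I, of "of_nat n" y "\<lambda>i. of_nat j + \<gamma> i"] n
    by (simp add: R_def add.assoc)
  ultimately have "card {i \<in> I. y + \<alpha> i = 0} + (\<Sum>j<n. card {i \<in> I. of_nat n * y + of_nat j + \<beta> i = 0})
    = card {i \<in> I. y + \<beta> i = 0} + (\<Sum>j<n. card {i \<in> I. of_nat n * y + of_nat j + \<alpha> i = 0})"
    by simp
  hence "int (card {i \<in> I. y + \<alpha> i = 0}) + (\<Sum>j<n. int (card {i \<in> I. of_nat n * y + of_nat j + \<beta> i = 0}))
    = int (card {i \<in> I. y + \<beta> i = 0}) + (\<Sum>j<n. int (card {i \<in> I. of_nat n * y + of_nat j + \<alpha> i = 0}))"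
    by (simp only: of_nat_add[symmetric] of_nat_sum[symmetric])
  thus ?thesis by (simp add: net_order_def sum_subtractf)
qed

section \<open>Coefficients of the hypergeometric series\<close>

lemma hyp_series_nth_1: "fps_nth (hyp_series p a b) 1 = 1"
  by (simp add: hyp_series_def)

lemma hyp_series_nth_Suc:
  assumes "k \<ge> 1"
  shows "fps_nth (hyp_series p a b) (Suc k) = fps_nth (hyp_series p a b) k *
    ((\<Prod>i=1..p. of_nat k + (a i - 1)) / (\<Prod>i=1..p. of_nat k + (b i - 1)))"
proof -
  obtain l where k: "k = Suc l" using assms by (cases k) auto
  have "(\<Prod>i=1..p. pochhammer (c i) (Suc l)) =
      (\<Prod>i=1..p. pochhammer (c i) l) * (\<Prod>i=1..p. of_nat k + (c i - 1))" for c :: "nat \<Rightarrow> complex"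
    by (simp add: pochhammer_Suc prod.distrib[symmetric] k algebra_simps)
  thus ?thesis by (simp add: hyp_series_def k)
qed

lemma U_eigen_nth:
  assumes "U_op n f = fps_const ev * f"
  shows "fps_nth f (n * k) = ev * fps_nth f k"
  using arg_cong[OF assms, of "\<lambda>g. fps_nth g k"] by (simp add: U_op_def)

text \<open>
  By the recurrence a vanishing coefficient would make all later ones vanish, but the
  coefficients at the powers of \<open>n\<close> are the powers of the eigenvalue.
\<close>

lemma U_eigen_hyp_series_nth_nonzero:
  assumes n: "n \<ge> 2" and ev: "ev \<noteq> 0"
    and eig: "U_op n (hyp_series p a b) = fps_const ev * hyp_series p a b"
    and k: "k \<ge> 1"
  shows "fps_nth (hyp_series p a b) k \<noteq> 0"
proof
  let ?C = "fps_nth (hyp_series p a b)"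
  assume k0: "?C k = 0"
  have tail: "?C (k + m) = 0" for m
  proof (induction m)
    case (Suc m)
    thus ?case using hyp_series_nth_Suc[of "k + m" p a b] k by simp
  qed (use k0 in simp)
  have pow: "?C (n ^ m) = ev ^ m" for m
    by (induction m) (use hyp_series_nth_1 in \<open>auto simp: U_eigen_nth[OF eig]\<close>)
  have "k \<le> n ^ k" using n by (meson less_exp less_imp_le order.trans power_mono zero_le)
  then obtain m where "n ^ k = k + m" using le_Suc_ex by blast
  thus False using tail[of m] pow[of k] ev by simp
qed

section \<open>The eigenvalue\<close>

theorem theorem6p13:
  fixes n p :: nat and a b :: "nat \<Rightarrow> complex" and ev :: complex
  assumes "n \<ge> 1" and "p \<ge> 1"
    and "\<And>i. i \<in> {1..p} \<Longrightarrow> a i \<noteq> 0"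
    and "\<And>i. i \<in> {1..p} \<Longrightarrow> b i \<noteq> 0"
    and "\<And>i. i \<in> {1..p} \<Longrightarrow> b i \<notin> \<int>\<^sub>\<le>\<^sub>0"
    and "ev \<noteq> 0"
    and "U_op n (hyp_series p a b) = fps_const ev * hyp_series p a b"
  shows "ev = of_nat n powi (int (gam p b) - int (gam p a))"
proof -
  define C where "C = fps_nth (hyp_series p a b)"
  have eig: "C (n * k) = ev * C k" for k
    using U_eigen_nth[OF assms(7)] by (simp add: C_def)
  have C1: "C 1 = 1" using hyp_series_nth_1[of p a b] by (simp add: C_def)
  have Cn: "C n = ev" using eig[of 1] C1 by simp
  show ?thesis
  proof (cases "n = 1")
    case True
    thus ?thesis using Cn C1 by simp
  next
    case False
    hence n: "n \<ge> 2" using assms(1) by simp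
    define \<alpha> where "\<alpha> i = a i - 1" for i
    define \<beta> where "\<beta> i = b i - 1" for i
    define P where "P x = (\<Prod>i=1..p. x + \<alpha> i)" for x
    define Q where "Q x = (\<Prod>i=1..p. x + \<beta> i)" for x
    define D where "D = net_order {1..p} \<alpha> \<beta>"
    have Cnz: "C k \<noteq> 0" if "k \<ge> 1" for k
      using U_eigen_hyp_series_nth_nonzero[OF n assms(6,7) that] by (simp add: C_def)
    have rec: "C (Suc k) / C k = P (of_nat k) / Q (of_nat k)" if "k \<ge> 1" for k
      using hyp_series_nth_Suc[OF that, of p a b] Cnz[OF that]
      by (simp add: C_def P_def Q_def \<alpha>_def \<beta>_def)
    \<comment> \<open>With \<open>x / 0 = 0\<close>, the quotient \<open>P k / Q k\<close> can only be non-zero if \<open>P k\<close> and \<open>Q k\<close> both are.\<close>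
    have PQnz: "P (of_nat k) \<noteq> 0" "Q (of_nat k) \<noteq> 0" if "k \<ge> 1" for k
      using rec[OF that] Cnz[OF that] Cnz[of "Suc k"] by auto

    have ratio: "C (Suc m) / C m = (\<Prod>j<n. C (Suc (n * m + j)) / C (n * m + j))"
      if "m \<ge> 1" for m
    proof -
      have "(\<Prod>j<n. C (n * m + Suc j) / C (n * m + j)) = C (n * m + n) / C (n * m + 0)"
        using that n by (intro prod_lessThan_telescope Cnz) (simp add: Suc_le_eq)
      also have "\<dots> = C (n * Suc m) / C (n * m)" by (simp add: add.commute)
      also have "\<dots> = C (Suc m) / C m" using assms(6) by (simp only: eig) simp
      finally show ?thesis by simp
    qed
    have eq: "P x * (\<Prod>j<n. Q (of_nat n * x + of_nat j)) = Q x * (\<Prod>j<n. P (of_nat n * x + of_nat j))"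
      if x: "x \<in> of_nat ` {1..}" for x
    proof -
      obtain m where m: "x = of_nat m" "m \<ge> 1" using x by auto
      have nm: "n * m + j \<ge> 1" for j using m n by (simp add: Suc_le_eq)
      have "P x / Q x = (\<Prod>j<n. P (of_nat (n * m + j)) / Q (of_nat (n * m + j)))"
        using ratio[OF m(2)] rec[OF m(2)] rec[OF nm] m by simp
      also have "\<dots> = (\<Prod>j<n. P (of_nat n * x + of_nat j)) / (\<Prod>j<n. Q (of_nat n * x + of_nat j))"
        by (simp add: prod_dividef m)
      finally have *: "P x / Q x = \<dots>" .
      have "Q (of_nat n * x + of_nat j) \<noteq> 0" for j
        using PQnz(2)[OF nm, of j] m by simp
      hence "(\<Prod>j<n. Q (of_nat n * x + of_nat j)) \<noteq> 0" by simp
      with * PQnz(2)[OF m(2)] m(1) show ?thesis by (simp add: field_simps)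
    qed
    have "infinite (of_nat ` {1..} :: complex set)"
      by (subst finite_image_iff) (auto simp: inj_on_def infinite_Ici)
    hence DT: "D y = (\<Sum>j<n. D (of_nat n * y + of_nat j))" for y
      unfolding D_def
      by (rule net_order_self_similar[rotated 2]) (use eq n in \<open>auto simp: P_def Q_def\<close>)
    have "finite {y. D y \<noteq> 0}"
      unfolding D_def by (rule finite_subset[OF net_order_support]) simp
    from self_similar_divisor[OF n this DT]
    have supp: "{y. D y \<noteq> 0} \<subseteq> {0, -1}" and "D 0 + D (-1) = 0" by blast+
    hence Dm: "D (-1) = - D 0" by simp

    have C: "C (Suc k) = of_nat (Suc k) powi (- D 0)" for k
    proof (induction k)
      case (Suc k)
      let ?x = "of_nat (Suc k) :: complex"
      have "?x + 1 = of_nat (Suc (Suc k))" by simp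
      hence x1: "?x + 1 \<noteq> 0" by (metis of_nat_neq_0)
      hence x0: "?x \<noteq> 0" "?x \<noteq> -1" "?x + 1 \<noteq> 0"
        using of_nat_neq_0 by (auto simp del: of_nat_Suc)
      have "P ?x / Q ?x = (\<Prod>y\<in>{0, -1}. (?x - y) powi D y)"
        using supp x0 PQnz[of "Suc k"] unfolding P_def Q_def D_def
        by (intro prod_ratio_eq_prod_net_order) (auto simp del: of_nat_Suc)
      also have "\<dots> = ?x powi D 0 * (?x + 1) powi (- D 0)"
        by (simp add: Dm del: of_nat_Suc)
      finally have "C (Suc (Suc k)) = C (Suc k) * (?x powi D 0 * (?x + 1) powi (- D 0))"
        using rec[of "Suc k"] Cnz[of "Suc k"] by (simp add: field_simps del: of_nat_Suc)
      thus ?case using Suc x0 by (simp add: power_int_minus add.commute del: of_nat_Suc add: of_nat_Suc[of "Suc k"])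
    qed (use C1 in simp)
    have "D 0 = int (gam p a) - int (gam p b)"
      by (simp add: D_def net_order_def gam_def \<alpha>_def \<beta>_def)
    with C[of "n - 1"] Cn n show ?thesis by simp
  qed
qed

end
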